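(* Let $\alpha,\beta>-1$ and let $P^{(\alpha,\beta)}_{n,k}(x,y)$, $0\le k\le n$, be the Laguerre-Jacobi Koornwinder polynomials. For $k\geq 0$ and $n\geq k+1$, $$\frac{\partial}{\partial \alpha} P^{(\alpha,\beta)}_{n,k}(x,y)=\sum_{s=0}^{n-k-1}\frac{1}{n-k-s}P^{(\alpha,\beta)}_{k+s,k}(x,y),$$ and $\frac{\partial}{\partial \alpha} P^{(\alpha,\beta)}_{n,n}(x,y)=0$ for $n=k\geq 0$. Similarly, for $n\geq k\geq 1$, $$\frac{\partial}{\partial \beta}P^{(\alpha,\beta)}_{n,k}(x,y)=\sum_{s=0}^{k-1}\frac{1}{\beta+k+s+1} P^{(\alpha,\beta)}_{n,k}(x,y)+\sum_{s=0}^{k-1}\frac{(\beta+2k-2s-1)(k-s)_{s+1}}{(s+1)(\beta+2k-s)(\beta+k-s)_{s+1}}\,x^{s+1}P^{(\alpha+2s+2,\beta)}_{n-s-1,k-s-1}(x,y),$$ and $\frac{\partial}{\partial \beta}P^{(\alpha,\beta)}_{n,0}(x,y)=0$ for $n\geq 0$, $k=0$. The parametric derivative with respect to the parameter $\beta$ is not in the form $$\frac{\partial P_{n,k}(\lambda;x,y)}{\partial\lambda}=\sum_{m=0}^{n-1}\sum_{j=0}^{m}d_{n,j,m}P_{m,j}(\lambda;x,y)+\sum_{j=0}^{k}e_{n,j,k}P_{n,j}(\lambda;x,y)$$ (with $\lambda=\beta$), since the coefficients include the variable $x$.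
   Context: The classical Jacobi polynomials are $P_{n}^{(a,b)}(x)=\frac{(-1)^{n}}{2^{n}n!}(1-x)^{-a}(1+x)^{-b}\frac{d^{n}}{dx^{n}}\{(1-x)^{n+a}(1+x)^{n+b}\}$ and the generalized Laguerre polynomials are $L_{n}^{(a)}(x)=\frac{x^{-a}e^{x}}{n!}\frac{d^{n}}{dx^{n}}\{e^{-x}x^{n+a}\}$. The Pochhammer symbol is $(a)_0=1$, $(a)_k=a(a+1)\cdots(a+k-1)$ for $k\ge1$. For $\alpha,\beta>-1$ and integers $0\le k\le n$, the Laguerre-Jacobi Koornwinder polynomials are $$P^{(\alpha,\beta)}_{n,k}(x,y)=L^{(\alpha+2k+1)}_{n-k}(x)\,x^{k}\,P^{(\beta,0)}_{k}\!\left(\frac{y}{x}\right),$$ where $P_k^{(\beta,0)}$ is a one-variable Jacobi polynomial. In the general expansion form displayed in the claim, $P_{n,k}(\lambda;x,y)$, $0\le k\le n$, denotes a family of orthogonal polynomials in $x,y$ depending on a parameter $\lambda$, and $d_{n,j,m}$, $e_{n,j,k}$ are coefficients that do not involve the variable $x$. *)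

theory Defs
  imports "HOL-Analysis.Analysis" "HOL-Computational_Algebra.Polynomial"
begin

text \<open>
  The Rodrigues formulas involve real powers of \<open>x\<close>, respectively of \<open>1 - x\<close> and \<open>1 + x\<close>, and
  so make sense on \<open>x > 0\<close>, respectively on \<open>- 1 < x < 1\<close>. The polynomial is the unique one
  that agrees with the Rodrigues formula there; existence and uniqueness are the lemmas
  \<open>laguerre_ex1\<close> and \<open>jacobi_ex1\<close> below.
\<close>

definition laguerre_rodrigues :: "nat \<Rightarrow> real \<Rightarrow> real \<Rightarrow> real" where
  "laguerre_rodrigues n a x =
     x powr (- a) * exp x / fact n * (deriv ^^ n) (\<lambda>t. exp (- t) * t powr (real n + a)) x"

definition laguerre :: "nat \<Rightarrow> real \<Rightarrow> real poly" where
  "laguerre n a = (THE p. \<forall>x>0. poly p x = laguerre_rodrigues n a x)"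

definition jacobi_rodrigues :: "nat \<Rightarrow> real \<Rightarrow> real \<Rightarrow> real \<Rightarrow> real" where
  "jacobi_rodrigues n a b x =
     (- 1) ^ n / (2 ^ n * fact n) * (1 - x) powr (- a) * (1 + x) powr (- b) *
     (deriv ^^ n) (\<lambda>t. (1 - t) powr (real n + a) * (1 + t) powr (real n + b)) x"

definition jacobi :: "nat \<Rightarrow> real \<Rightarrow> real \<Rightarrow> real poly" where
  "jacobi n a b = (THE p. \<forall>x\<in>{-1<..<1}. poly p x = jacobi_rodrigues n a b x)"

lemma deriv_iterate_on_open:
  fixes f :: "real \<Rightarrow> real" and g :: "nat \<Rightarrow> real \<Rightarrow> real"
  assumes "open S"
    and "\<And>x. x \<in> S \<Longrightarrow> f x = g 0 x"
    and "\<And>j x. x \<in> S \<Longrightarrow> (g j has_real_derivative g (Suc j) x) (at x)"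
  shows "x \<in> S \<Longrightarrow> (deriv ^^ j) f x = g j x"
proof (induction j arbitrary: x)
  case 0
  then show ?case using assms(2) by simp
next
  case (Suc j)
  have "((deriv ^^ j) f has_real_derivative g (Suc j) x) (at x)"
    by (rule has_field_derivative_transform_within_open[OF assms(3)[OF Suc.prems] assms(1) Suc.prems])
       (simp add: Suc.IH)
  then show ?case by (simp add: DERIV_imp_deriv)
qed

lemma poly_eq_if_agree_on_infinite:
  fixes p q :: "real poly"
  assumes "infinite S" and "\<And>x. x \<in> S \<Longrightarrow> poly p x = poly q x"
  shows "p = q"
proof (rule ccontr)
  assume "p \<noteq> q"
  then have "finite {x. poly (p - q) x = 0}" by (intro poly_roots_finite) simp
  moreover have "S \<subseteq> {x. poly (p - q) x = 0}" using assms(2) by auto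
  ultimately show False using assms(1) finite_subset by blast
qed

lemma laguerre_ex1: "\<exists>!p. \<forall>x>0. poly p x = laguerre_rodrigues n a x"
proof -
  define c where "c = real n + a"
  define q :: "nat \<Rightarrow> real poly" where
    "q = rec_nat 1 (\<lambda>j p. smult (c - real j) p - [:0, 1:] * p + [:0, 1:] * pderiv p)"
  define g where "g = (\<lambda>j x. exp (- x) * x powr (c - real j) * poly (q j) x)"
  have q_Suc: "q (Suc j) = smult (c - real j) (q j) - [:0, 1:] * q j + [:0, 1:] * pderiv (q j)" for j
    by (simp add: q_def)
  have g_deriv: "(g j has_real_derivative g (Suc j) x) (at x)" if "x > 0" for j x
  proof -
    have eq: "x powr (c - real j) = x * x powr (c - real (Suc j))"
      using that by (simp add: powr_mult_base)
    have "(g j has_real_derivative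
        - exp (- x) * x powr (c - real j) * poly (q j) x
        + exp (- x) * ((c - real j) * x powr (c - real j - 1)) * poly (q j) x
        + exp (- x) * x powr (c - real j) * poly (pderiv (q j)) x) (at x)"
      unfolding g_def using that
      by (auto intro!: derivative_eq_intros simp: algebra_simps)
    also have "c - real j - 1 = c - real (Suc j)" by simp
    finally show ?thesis
      unfolding g_def q_Suc eq by (simp add: algebra_simps)
  qed
  have "(deriv ^^ n) (\<lambda>t. exp (- t) * t powr c) x = g n x" if "x > 0" for x
    by (rule deriv_iterate_on_open[of "{0<..}"]) (use that g_deriv in \<open>auto simp: g_def q_def\<close>)
  then have "laguerre_rodrigues n a x = poly (smult (1 / fact n) (q n)) x" if "x > 0" for x
    using that by (simp add: laguerre_rodrigues_def c_def g_def exp_minus powr_minus field_simps)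
  then have ex: "\<forall>x>0. poly (smult (1 / fact n) (q n)) x = laguerre_rodrigues n a x" by simp
  have "p = p'" if "\<forall>x>0. poly p x = laguerre_rodrigues n a x"
    and "\<forall>x>0. poly p' x = laguerre_rodrigues n a x" for p p'
    by (rule poly_eq_if_agree_on_infinite[of "{0<..}"]) (use that in \<open>auto simp: infinite_Ioi\<close>)
  with ex show ?thesis by blast
qed

lemma jacobi_ex1: "\<exists>!p. \<forall>x\<in>{-1<..<1}. poly p x = jacobi_rodrigues n a b x"
proof -
  define c where "c = real n + a"
  define d where "d = real n + b"
  define q :: "nat \<Rightarrow> real poly" where
    "q = rec_nat 1 (\<lambda>j p. smult (d - real j) ([:1, -1:] * p) - smult (c - real j) ([:1, 1:] * p)
                          + [:1, -1:] * ([:1, 1:] * pderiv p))"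
  define g where
    "g = (\<lambda>j x. (1 - x) powr (c - real j) * (1 + x) powr (d - real j) * poly (q j) x)"
  have q_Suc: "q (Suc j) = smult (d - real j) ([:1, -1:] * q j) - smult (c - real j) ([:1, 1:] * q j)
                          + [:1, -1:] * ([:1, 1:] * pderiv (q j))" for j
    by (simp add: q_def)
  have g_deriv: "(g j has_real_derivative g (Suc j) x) (at x)" if "x \<in> {-1<..<1}" for j x
  proof -
    have eq: "(1 - x) powr (c - real j) = (1 - x) * (1 - x) powr (c - real (Suc j))"
      "(1 + x) powr (d - real j) = (1 + x) * (1 + x) powr (d - real (Suc j))"
      using that by (simp_all add: powr_mult_base)
    have "(g j has_real_derivative
        - ((c - real j) * (1 - x) powr (c - real j - 1)) * (1 + x) powr (d - real j) * poly (q j) x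
        + (1 - x) powr (c - real j) * ((d - real j) * (1 + x) powr (d - real j - 1)) * poly (q j) x
        + (1 - x) powr (c - real j) * (1 + x) powr (d - real j) * poly (pderiv (q j)) x) (at x)"
      unfolding g_def using that
      by (auto intro!: derivative_eq_intros simp: algebra_simps)
    also have "c - real j - 1 = c - real (Suc j)" by simp
    also have "d - real j - 1 = d - real (Suc j)" by simp
    finally show ?thesis
      unfolding g_def q_Suc eq by (simp add: algebra_simps)
  qed
  have "(deriv ^^ n) (\<lambda>t. (1 - t) powr c * (1 + t) powr d) x = g n x" if "x \<in> {-1<..<1}" for x
    by (rule deriv_iterate_on_open[of "{-1<..<1}"]) (use that g_deriv in \<open>auto simp: g_def q_def\<close>)
  then have "jacobi_rodrigues n a b x = poly (smult ((- 1) ^ n / (2 ^ n * fact n)) (q n)) x"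
    if "x \<in> {-1<..<1}" for x
    using that by (simp add: jacobi_rodrigues_def c_def d_def g_def powr_minus field_simps)
  then have ex: "\<forall>x\<in>{-1<..<1}.
      poly (smult ((- 1) ^ n / (2 ^ n * fact n)) (q n)) x = jacobi_rodrigues n a b x" by simp
  have "p = p'" if "\<forall>x\<in>{-1<..<1}. poly p x = jacobi_rodrigues n a b x"
    and "\<forall>x\<in>{-1<..<1}. poly p' x = jacobi_rodrigues n a b x" for p p'
    by (rule poly_eq_if_agree_on_infinite[of "{-1<..<1}"]) (use that in auto)
  with ex show ?thesis by blast
qed

text \<open>Because of \<open>y / x\<close>, this is the value of the Koornwinder polynomial only for \<open>x \<noteq> 0\<close>.\<close>

definition koornwinder :: "real \<Rightarrow> real \<Rightarrow> nat \<Rightarrow> nat \<Rightarrow> real \<Rightarrow> real \<Rightarrow> real" where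
  "koornwinder \<alpha> \<beta> n k x y =
     poly (laguerre (n - k) (\<alpha> + 2 * real k + 1)) x * x ^ k * poly (jacobi k \<beta> 0) (y / x)"

text \<open>
  The coefficient of \<open>koornwinder (\<alpha> + 2 * s + 2) \<beta> (n - s - 1) (k - s - 1) x y\<close> in the
  expansion of the derivative with respect to \<open>\<beta>\<close>. It depends on \<open>x\<close>.
\<close>

definition beta_coeff :: "real \<Rightarrow> nat \<Rightarrow> nat \<Rightarrow> real \<Rightarrow> real" where
  "beta_coeff \<beta> k s x =
     (\<beta> + 2 * real k - 2 * real s - 1) * pochhammer (real k - real s) (s + 1) /
     ((real s + 1) * (\<beta> + 2 * real k - real s) * pochhammer (\<beta> + real k - real s) (s + 1)) * x ^ (s + 1)"

text \<open>
  The general expansion form at level \<open>n\<close> and parameter value \<open>lam\<close>, for all \<open>k \<le> n\<close> at once: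
  as the subscripts say, \<open>d\<^bsub>n,j,m\<^esub>\<close> does not vary with \<open>k\<close>. The coefficients may depend on
  \<open>lam\<close> (which is fixed when they are chosen) and on \<open>y\<close>, but not on \<open>x\<close>.
\<close>

definition has_expansion_form ::
    "(real \<Rightarrow> nat \<Rightarrow> nat \<Rightarrow> real \<Rightarrow> real \<Rightarrow> real) \<Rightarrow> real \<Rightarrow> nat \<Rightarrow> bool" where
  "has_expansion_form P lam n \<longleftrightarrow>
     (\<exists>d e :: nat \<Rightarrow> nat \<Rightarrow> nat \<Rightarrow> real \<Rightarrow> real. \<forall>k\<le>n. \<forall>x y. x \<noteq> 0 \<longrightarrow>
        ((\<lambda>l. P l n k x y) has_real_derivative
          (\<Sum>m<n. \<Sum>j\<le>m. d n j m y * P lam m j x y) + (\<Sum>j\<le>k. e n j k y * P lam n j x y)) (at lam))"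

end

theory Submission
  imports Defs "HOL-Computational_Algebra.Formal_Power_Series"
begin

text \<open>
  A Koornwinder polynomial is a Laguerre factor that carries \<open>\<alpha>\<close>, times \<open>x\<^sup>k\<close>, times a Jacobi
  factor that carries \<open>\<beta>\<close>. So each parametric derivative is that of one classical polynomial in one
  variable, and these are found coefficient by coefficient from explicit expansions.

  The Leibniz rule applied to the Rodrigues formulas gives
  \<open>L\<^sub>n\<^sup>(\<^sup>a\<^sup>)(x) = \<Sum>\<^sub>i (-x)\<^sup>i/i! (a+i+1)\<^sub>n\<^sub>-\<^sub>i/(n-i)!\<close> and, after Vandermonde's identity,
  \<open>P\<^sub>n\<^sup>(\<^sup>a\<^sup>,\<^sup>0\<^sup>)(z) = \<Sum>\<^sub>j (n choose j) (a+j+1)\<^sub>n/n! w\<^sup>j\<close> with \<open>w = (z-1)/2\<close>. The second Jacobi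
  parameter being \<open>0\<close> is what lets the usual two Pochhammer factors merge into one. The parameter now
  sits in rising factorials only.

  For Laguerre, \<open>(b)\<^sub>N/N!\<close> is the coefficient of \<open>t\<^sup>N\<close> in \<open>(1-t)\<^sup>-\<^sup>b\<close>, and differentiating that
  series in \<open>b\<close> multiplies it by \<open>-ln (1-t) = \<Sum> t\<^sup>i/i\<close>; the resulting convolution is
  \<open>has_derivative_pochhammer_div_fact\<close>, and it holds with the same weights for every coefficient.

  For Jacobi, the logarithmic derivative of \<open>(a+j+1)\<^sub>n\<close> is the sum of \<open>1/(a+j+1+i)\<close> over \<open>i < n\<close>. Its value
  at \<open>j = n\<close> is common to all coefficients and yields the multiple of \<open>P\<^sub>n\<close> itself. The difference
  between the values at \<open>j\<close> and \<open>n\<close> must come from the lower polynomials, which is the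
  identity \<open>sum_jacobi_kernel\<close>. It is proved by downward induction on \<open>j\<close>: the increment in \<open>j\<close> of
  each summand is itself a difference in the summation variable, so the increment of the sum telescopes.

  For the impossibility of the expansion form, let \<open>D\<close> be the part of lower total degree, which is the same
  for all \<open>k\<close>. Taking \<open>k = 0\<close>, where the derivative vanishes, expresses \<open>D\<close> by \<open>P\<^sub>n\<^sub>,\<^sub>0\<close>. Inserting this for
  \<open>k = 1\<close> gives, for each fixed \<open>y\<close>, an equation in \<open>x\<close> that makes a Laguerre polynomial times a linear factor
  a multiple of another one. By \<open>linear_times_laguerre_eq_laguerre\<close> this forces the linear factor to vanish
  when \<open>n > 1\<close>, and for a suitable \<open>y\<close> it cannot; \<open>n = 1\<close> is refuted by one more special \<open>y\<close>.
\<close>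

section \<open>Iterated derivatives of products and of powers\<close>

lemma leibniz_sum_step:
  fixes u v :: "nat \<Rightarrow> real"
  shows "(\<Sum>i\<le>j. real (j choose i) * (u (Suc i) * v (j - i) + u i * v (Suc (j - i)))) =
         (\<Sum>i\<le>Suc j. real (Suc j choose i) * (u i * v (Suc j - i)))"
proof -
  have "(\<Sum>i\<le>Suc j. real (Suc j choose i) * (u i * v (Suc j - i))) =
        u 0 * v (Suc j) + (\<Sum>i\<le>j. real (j choose Suc i) * (u (Suc i) * v (j - i)))
        + (\<Sum>i\<le>j. real (j choose i) * (u (Suc i) * v (j - i)))"
    by (subst sum.atMost_Suc_shift) (simp add: sum.distrib algebra_simps)
  also have "u 0 * v (Suc j) + (\<Sum>i\<le>j. real (j choose Suc i) * (u (Suc i) * v (j - i))) =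
        (\<Sum>i\<le>Suc j. real (j choose i) * (u i * v (Suc j - i)))"
    unfolding sum.atMost_Suc_shift by simp
  also have "\<dots> = (\<Sum>i\<le>j. real (j choose i) * (u i * v (Suc (j - i))))"
    by (simp add: Suc_diff_le)
  finally show ?thesis
    by (simp add: sum.distrib algebra_simps)
qed

text \<open>
  Both Rodrigues formulas differentiate a product of two functions whose derivatives of all orders are
  known, so the rule takes the two families of derivatives \<open>u\<close> and \<open>v\<close> as given.
\<close>

lemma leibniz_deriv_iterate:
  fixes u v :: "nat \<Rightarrow> real \<Rightarrow> real"
  assumes S: "open S"
    and u: "\<And>j x. x \<in> S \<Longrightarrow> (u j has_real_derivative u (Suc j) x) (at x)"
    and v: "\<And>j x. x \<in> S \<Longrightarrow> (v j has_real_derivative v (Suc j) x) (at x)"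
    and x: "x \<in> S"
  shows "(deriv ^^ n) (\<lambda>t. u 0 t * v 0 t) x =
         (\<Sum>i\<le>n. real (n choose i) * (u i x * v (n - i) x))"
proof (rule deriv_iterate_on_open[OF S _ _ x])
  fix j x assume "x \<in> S"
  show "((\<lambda>x. \<Sum>i\<le>j. real (j choose i) * (u i x * v (j - i) x)) has_real_derivative
         (\<Sum>i\<le>Suc j. real (Suc j choose i) * (u i x * v (Suc j - i) x))) (at x)"
    unfolding leibniz_sum_step[of j "\<lambda>i. u i x" "\<lambda>i. v i x", symmetric]
  proof (intro DERIV_sum DERIV_cmult)
    fix i
    show "((\<lambda>x. u i x * v (j - i) x) has_real_derivative
           u (Suc i) x * v (j - i) x + u i x * v (Suc (j - i)) x) (at x)"
      using DERIV_mult[OF u[OF \<open>x \<in> S\<close>, of i] v[OF \<open>x \<in> S\<close>, of "j - i"]]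
      by (simp add: mult.commute)
  qed
qed simp

text \<open>
  The falling factorial \<open>c (c - 1) \<dots> (c - j + 1)\<close> is written as a rising one, because the explicit formulas
  for both polynomials use rising factorials of the parameter. The bases needed are \<open>x\<close>, \<open>1 - x\<close> and \<open>1 + x\<close>.
\<close>

lemma has_derivative_shifted_power:
  fixes c r s x :: real
  assumes "r + s * x > 0"
  shows "((\<lambda>x. s ^ j * pochhammer (c - real j + 1) j * (r + s * x) powr (c - real j)) has_real_derivative
         s ^ Suc j * pochhammer (c - real (Suc j) + 1) (Suc j) * (r + s * x) powr (c - real (Suc j))) (at x)"
proof -
  have "((\<lambda>x. (r + s * x) powr (c - real j)) has_real_derivative
        (c - real j) * (r + s * x) powr (c - real (Suc j)) * s) (at x)"
    using assms by (auto intro!: derivative_eq_intros simp: algebra_simps)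
  from DERIV_cmult[OF this, of "s ^ j * pochhammer (c - real j + 1) j"] show ?thesis
    by (rule DERIV_cong) (simp add: pochhammer_rec algebra_simps)
qed

section \<open>Laguerre polynomials and their derivative in the parameter\<close>

text \<open>
  In the Leibniz expansion the powers \<open>x\<^sup>a\<^sup>+\<^sup>i\<close> of the second factor cancel the prefactor
  \<open>x\<^sup>-\<^sup>a\<close> up to \<open>x\<^sup>i\<close>, and the exponentials cancel.
\<close>

lemma laguerre_eq_sum_monom:
  "laguerre n a =
     (\<Sum>i\<le>n. monom ((- 1) ^ i * pochhammer (a + real i + 1) (n - i) / (fact i * fact (n - i))) i)"
  (is "_ = ?q")
  unfolding laguerre_def
proof (rule the1_equality[OF laguerre_ex1], intro allI impI)
  fix x :: real assume x: "x > 0"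
  define c where "c = real n + a"
  have "(deriv ^^ n) (\<lambda>t. exp (- t) * t powr c) x =
    (\<Sum>i\<le>n. real (n choose i) * (((- 1) ^ i * exp (- x)) *
       (pochhammer (c - real (n - i) + 1) (n - i) * x powr (c - real (n - i)))))"
  proof -
    have u: "((\<lambda>t. (- 1) ^ i * exp (- t)) has_real_derivative (- 1) ^ Suc i * exp (- y)) (at y)"
      for i y by (auto intro!: derivative_eq_intros)
    have v: "((\<lambda>t. pochhammer (c - real i + 1) i * t powr (c - real i)) has_real_derivative
        pochhammer (c - real (Suc i) + 1) (Suc i) * y powr (c - real (Suc i))) (at y)"
      if "y \<in> {0<..}" for i y
      using has_derivative_shifted_power[of 0 1 y i c] that by (simp only: power_one mult_1 add_0) simp
    show ?thesis
      using leibniz_deriv_iterate[where S = "{0<..}" and x = x and n = n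
            and u = "\<lambda>i t. (- 1) ^ i * exp (- t)"
            and v = "\<lambda>i t. pochhammer (c - real i + 1) i * t powr (c - real i)",
          OF open_greaterThan u v] x by simp
  qed
  also have "\<dots> = (\<Sum>i\<le>n. real (n choose i) * (- 1) ^ i * pochhammer (a + real i + 1) (n - i)
       * x ^ i * (exp (- x) * x powr a))"
  proof (rule sum.cong[OF refl])
    fix i assume "i \<in> {..n}"
    then have "c - real (n - i) = a + real i" by (simp add: c_def of_nat_diff)
    then show "real (n choose i) * (((- 1) ^ i * exp (- x)) *
       (pochhammer (c - real (n - i) + 1) (n - i) * x powr (c - real (n - i)))) =
       real (n choose i) * (- 1) ^ i * pochhammer (a + real i + 1) (n - i)
       * x ^ i * (exp (- x) * x powr a)"
      using x by (simp add: powr_add powr_realpow)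
  qed
  also have "\<dots> = (\<Sum>i\<le>n. real (n choose i) * (- 1) ^ i * pochhammer (a + real i + 1) (n - i) * x ^ i)
       * (exp (- x) * x powr a)"
    by (simp add: sum_distrib_right)
  finally have "laguerre_rodrigues n a x =
     (\<Sum>i\<le>n. real (n choose i) * (- 1) ^ i * pochhammer (a + real i + 1) (n - i) * x ^ i) / fact n"
    using x by (simp add: laguerre_rodrigues_def c_def powr_minus exp_minus field_simps)
  also have "\<dots> = poly ?q x"
    unfolding poly_sum poly_monom sum_divide_distrib
    by (rule sum.cong[OF refl]) (simp add: binomial_fact)
  finally show "poly ?q x = laguerre_rodrigues n a x" by simp
qed

lemma coeff_laguerre:
  "coeff (laguerre n a) i =
     (if i \<le> n then (- 1) ^ i * pochhammer (a + real i + 1) (n - i) / (fact i * fact (n - i)) else 0)"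
  by (simp add: laguerre_eq_sum_monom coeff_sum)

lemma poly_laguerre:
  "poly (laguerre n a) x =
     (\<Sum>i\<le>n. (- x) ^ i / fact i * (pochhammer (a + real i + 1) (n - i) / fact (n - i)))"
  by (simp add: laguerre_eq_sum_monom poly_sum poly_monom power_minus[of x] mult_ac)

lemma pochhammer_div_fact_Suc:
  "real (Suc N) * (pochhammer b (Suc N) / fact (Suc N)) = (b + real N) * (pochhammer b N / fact N)" for b :: real
  by (simp add: pochhammer_rec')

text \<open>
  Formally this compares coefficients in the derivative of \<open>(1-t)\<^sup>-\<^sup>b\<close> with respect to \<open>b\<close>, which is
  \<open>-ln (1-t) (1-t)\<^sup>-\<^sup>b\<close>. The proof by induction instead differentiates the recurrence
  \<open>(N+1) p\<^sub>N\<^sub>+\<^sub>1 = (b+N) p\<^sub>N\<close> for \<open>p\<^sub>N = (b)\<^sub>N/N!\<close>; splitting \<open>b + N = (b + m) + (N - m)\<close>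
  in the \<open>m\<close>-th term makes the recurrence applicable again.
\<close>

lemma has_derivative_pochhammer_div_fact:
  fixes b :: real
  shows "((\<lambda>b. pochhammer b N / fact N) has_real_derivative
          (\<Sum>m<N. 1 / real (N - m) * (pochhammer b m / fact m))) (at b)"
proof (induction N)
  case 0
  show ?case by simp
next
  case (Suc N)
  define p where "p = (\<lambda>m. pochhammer b m / fact m)"
  define D where "D = (\<Sum>m<N. 1 / real (N - m) * p m)"
  have p_Suc: "real (Suc m) * p (Suc m) = (b + real m) * p m" for m
    unfolding p_def by (rule pochhammer_div_fact_Suc)
  have "((\<lambda>b. (b + real N) * (pochhammer b N / fact N)) has_real_derivative
         p N + (b + real N) * D) (at b)"
    using Suc.IH unfolding p_def D_def
    by (intro DERIV_cong[OF DERIV_mult[OF DERIV_add[OF DERIV_ident DERIV_const]]]) (auto simp: mult.commute)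
  then have "((\<lambda>b. real (Suc N) * (pochhammer b (Suc N) / fact (Suc N))) has_real_derivative
         p N + (b + real N) * D) (at b)"
    by (simp only: pochhammer_div_fact_Suc)
  then have "((\<lambda>b. real (Suc N) * (pochhammer b (Suc N) / fact (Suc N)) / real (Suc N)) has_real_derivative
         (p N + (b + real N) * D) / real (Suc N)) (at b)"
    by (rule DERIV_cdivide)
  then have main: "((\<lambda>b. pochhammer b (Suc N) / fact (Suc N)) has_real_derivative
         (p N + (b + real N) * D) / real (Suc N)) (at b)"
    by (simp add: mult.commute)
  have "(b + real N) * D = (\<Sum>m<N. p m + 1 / real (N - m) * (real (Suc m) * p (Suc m)))"
    unfolding D_def sum_distrib_left
  proof (rule sum.cong[OF refl])
    fix m assume "m \<in> {..<N}"
    then have r: "real (N - m) > 0" "real N = real (N - m) + real m" by auto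
    show "(b + real N) * (1 / real (N - m) * p m) = p m + 1 / real (N - m) * (real (Suc m) * p (Suc m))"
      unfolding p_Suc using r(1) unfolding r(2) by (simp add: field_simps del: of_nat_diff)
  qed
  also have "\<dots> = (\<Sum>m<N. p m) + (\<Sum>m<Suc N. real m / real (Suc N - m) * p m)"
    by (subst sum.lessThan_Suc_shift) (simp add: sum.distrib)
  finally have "p N + (b + real N) * D =
      (\<Sum>m<Suc N. p m + real m / real (Suc N - m) * p m)"
    by (simp add: sum.distrib)
  also have "\<dots> = (\<Sum>m<Suc N. real (Suc N) * (1 / real (Suc N - m) * p m))"
  proof (rule sum.cong[OF refl])
    fix m assume "m \<in> {..<Suc N}"
    then have r: "real (Suc N - m) > 0" "real (Suc N) = real (Suc N - m) + real m" by auto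
    show "p m + real m / real (Suc N - m) * p m = real (Suc N) * (1 / real (Suc N - m) * p m)"
      unfolding r(2) using r(1) by (simp add: field_simps del: of_nat_diff)
  qed
  also have "\<dots> = real (Suc N) * (\<Sum>m<Suc N. 1 / real (Suc N - m) * p m)"
    by (rule sum_distrib_left[symmetric])
  finally show ?case
    using main unfolding p_def by simp
qed

text \<open>
  The weight \<open>1/(n-s)\<close> that the coefficientwise derivative gives to index \<open>m = s - i\<close> depends on \<open>s\<close> only,
  which is why the terms can be collected into whole Laguerre polynomials of degree \<open>s\<close>.
\<close>

lemma laguerre_parametric_derivative:
  "((\<lambda>a. poly (laguerre n a) x) has_real_derivative
      (\<Sum>s<n. 1 / real (n - s) * poly (laguerre s a) x)) (at a)"
proof -
  let ?p = "\<lambda>m i. pochhammer (a + real i + 1) m / fact m"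
  have p_deriv: "((\<lambda>a. pochhammer (a + real i + 1) N / fact N) has_real_derivative
          (\<Sum>m<N. 1 / real (N - m) * ?p m i)) (at a)" for i N
    using has_derivative_pochhammer_div_fact[of N "a + real i + 1"]
      DERIV_shift[of "\<lambda>b. pochhammer b N / fact N" _ a "real i + 1"]
    by (simp add: add.assoc)
  have "((\<lambda>a. poly (laguerre n a) x) has_real_derivative
      (\<Sum>i\<le>n. (- x) ^ i / fact i * (\<Sum>m<n - i. 1 / real (n - i - m) * ?p m i))) (at a)"
    unfolding poly_laguerre by (intro DERIV_sum DERIV_cmult p_deriv)
  also have "(\<Sum>i\<le>n. (- x) ^ i / fact i * (\<Sum>m<n - i. 1 / real (n - i - m) * ?p m i)) =
      (\<Sum>i\<le>n. \<Sum>s | s \<in> {..<n} \<and> i \<le> s. (- x) ^ i / fact i * (1 / real (n - s) * ?p (s - i) i))"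
  proof (rule sum.cong[OF refl])
    fix i
    have "(\<Sum>m<n - i. 1 / real (n - i - m) * ?p m i) =
          (\<Sum>s | s \<in> {..<n} \<and> i \<le> s. 1 / real (n - s) * ?p (s - i) i)"
      by (rule sum.reindex_bij_witness[where i = "\<lambda>s. s - i" and j = "\<lambda>m. m + i"])
         (auto simp: add.commute)
    then show "(- x) ^ i / fact i * (\<Sum>m<n - i. 1 / real (n - i - m) * ?p m i) =
       (\<Sum>s | s \<in> {..<n} \<and> i \<le> s. (- x) ^ i / fact i * (1 / real (n - s) * ?p (s - i) i))"
      by (simp add: sum_distrib_left)
  qed
  also have "\<dots> = (\<Sum>s<n. \<Sum>i | i \<in> {..n} \<and> i \<le> s.
                    (- x) ^ i / fact i * (1 / real (n - s) * ?p (s - i) i))"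
    by (rule sum.swap_restrict) auto
  also have "\<dots> = (\<Sum>s<n. 1 / real (n - s) * poly (laguerre s a) x)"
    unfolding poly_laguerre sum_distrib_left by (intro sum.cong) auto
  finally show ?thesis .
qed

section \<open>Expansion of Jacobi polynomials at 1\<close>

lemma sum_binomial_gbinomial_Vandermonde:
  fixes c :: real
  assumes "j \<le> n"
  shows "(\<Sum>i\<le>j. real (j choose i) * (c gchoose (n - i))) = (c + real j) gchoose n"
proof -
  have "(c + real j) gchoose n = (\<Sum>i\<le>n. real (j choose i) * (c gchoose (n - i)))"
    using gbinomial_Vandermonde[of "real j" c n]
    by (simp add: binomial_gbinomial atLeast0AtMost add.commute)
  also have "\<dots> = (\<Sum>i\<le>j. real (j choose i) * (c gchoose (n - i)))"
    using assms by (intro sum.mono_neutral_right) auto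
  finally show ?thesis by simp
qed

text \<open>
  The left-hand side is what the Leibniz rule makes of the Rodrigues formula for \<open>b = 0\<close>. Expanding
  \<open>(1 + w)\<^sup>n\<^sup>-\<^sup>i\<close> and collecting the powers of \<open>w\<close> turns each coefficient into a Vandermonde sum.
\<close>

lemma sum_gbinomial_shift_powers:
  fixes c w :: real
  shows "(\<Sum>i\<le>n. (c gchoose (n - i)) * real (n choose i) * w ^ i * (1 + w) ^ (n - i)) =
         (\<Sum>j\<le>n. real (n choose j) * ((c + real j) gchoose n) * w ^ j)"
proof -
  let ?g = "\<lambda>i l. (c gchoose (n - i)) * real (n choose i) * real (n - i choose l) * w ^ (i + l)"
  have "(\<Sum>i\<le>n. (c gchoose (n - i)) * real (n choose i) * w ^ i * (1 + w) ^ (n - i)) =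
        (\<Sum>i\<le>n. \<Sum>l\<le>n - i. ?g i l)"
  proof (rule sum.cong[OF refl])
    fix i
    have "(1 + w) ^ (n - i) = (\<Sum>l\<le>n - i. real (n - i choose l) * w ^ l)"
      using binomial_ring[of w 1 "n - i"] by (simp add: add.commute)
    then show "(c gchoose (n - i)) * real (n choose i) * w ^ i * (1 + w) ^ (n - i) = (\<Sum>l\<le>n - i. ?g i l)"
      by (simp add: sum_distrib_left power_add mult_ac)
  qed
  also have "\<dots> = (\<Sum>(i, l)\<in>{(i, l). i + l \<le> n}. ?g i l)"
    by (subst sum.Sigma) (auto intro!: sum.cong)
  also have "\<dots> = (\<Sum>j\<le>n. \<Sum>i\<le>j. ?g i (j - i))"
    by (rule sum.triangle_reindex_eq)
  also have "\<dots> = (\<Sum>j\<le>n. real (n choose j) * ((c + real j) gchoose n) * w ^ j)"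
  proof (rule sum.cong[OF refl])
    fix j assume j: "j \<in> {..n}"
    have "(\<Sum>i\<le>j. ?g i (j - i)) =
      (\<Sum>i\<le>j. real (n choose j) * w ^ j * (real (j choose i) * (c gchoose (n - i))))"
    proof (rule sum.cong[OF refl])
      fix i assume i: "i \<in> {..j}"
      have "real (n choose i) * real (n - i choose (j - i)) = real (n choose j) * real (j choose i)"
        using choose_mult[of i j n] i j by (simp flip: of_nat_mult)
      then show "?g i (j - i) = real (n choose j) * w ^ j * (real (j choose i) * (c gchoose (n - i)))"
        using i by (simp add: mult_ac)
    qed
    also have "\<dots> = real (n choose j) * w ^ j * ((c + real j) gchoose n)"
      using j sum_binomial_gbinomial_Vandermonde[of j n c] by (simp flip: sum_distrib_left)
    finally show "(\<Sum>i\<le>j. ?g i (j - i)) = real (n choose j) * ((c + real j) gchoose n) * w ^ j"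
      by (simp add: mult_ac)
  qed
  finally show ?thesis .
qed

text \<open>
  Every term of the Leibniz expansion keeps the factor \<open>(1 - x)\<^sup>a\<close>, which the prefactor of the Rodrigues
  formula cancels; the remaining exponents are natural numbers. The variable \<open>w = (x - 1)/2\<close> absorbs the
  powers of \<open>2\<close>.
\<close>

lemma jacobi_eq_sum:
  "jacobi n a 0 =
     (\<Sum>j\<le>n. smult (real (n choose j) * (pochhammer (a + real j + 1) n / fact n)) ([:- 1 / 2, 1 / 2:] ^ j))"
  (is "_ = ?q")
  unfolding jacobi_def
proof (rule the1_equality[OF jacobi_ex1], intro ballI)
  fix x :: real assume x: "x \<in> {- 1<..<1}"
  define c where "c = real n + a"
  define w where "w = (x - 1) / 2"
  have x_w: "1 - x = 2 * - w" "1 + x = 2 * (1 + w)" by (simp_all add: w_def field_simps)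
  have u: "((\<lambda>t. (- 1) ^ i * pochhammer (c - real i + 1) i * (1 - t) powr (c - real i)) has_real_derivative
        (- 1) ^ Suc i * pochhammer (c - real (Suc i) + 1) (Suc i) * (1 - y) powr (c - real (Suc i))) (at y)"
    if "y \<in> {- 1<..<1}" for i y
    using has_derivative_shifted_power[of 1 "- 1" y i c] that by simp
  have v: "((\<lambda>t. pochhammer (real n - real i + 1) i * (1 + t) powr (real n - real i)) has_real_derivative
        pochhammer (real n - real (Suc i) + 1) (Suc i) * (1 + y) powr (real n - real (Suc i))) (at y)"
    if "y \<in> {- 1<..<1}" for i y
    using has_derivative_shifted_power[of 1 1 y i "real n"] that
    by (simp only: power_one mult_1) simp
  have "(deriv ^^ n) (\<lambda>t. (1 - t) powr c * (1 + t) powr real n) x =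
    (\<Sum>i\<le>n. real (n choose i) *
       (((- 1) ^ i * pochhammer (c - real i + 1) i * (1 - x) powr (c - real i)) *
        (pochhammer (real n - real (n - i) + 1) (n - i) * (1 + x) powr (real n - real (n - i)))))"
    using leibniz_deriv_iterate[where S = "{- 1<..<1}" and x = x and n = n
        and u = "\<lambda>i t. (- 1) ^ i * pochhammer (c - real i + 1) i * (1 - t) powr (c - real i)"
        and v = "\<lambda>i t. pochhammer (real n - real i + 1) i * (1 + t) powr (real n - real i)",
      OF open_greaterThanLessThan u v x] by simp
  also have "\<dots> = (\<Sum>i\<le>n. (1 - x) powr a * (fact n * (- 2) ^ n) *
       ((c gchoose i) * real (n choose i) * w ^ (n - i) * (1 + w) ^ i))"
  proof (rule sum.cong[OF refl])
    fix i assume i: "i \<in> {..n}"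
    have pows: "(1 - x) powr (c - real i) = (1 - x) powr a * (2 * - w) ^ (n - i)"
      "(1 + x) powr (real n - real (n - i)) = (2 * (1 + w)) ^ i"
    proof -
      have "c - real i = a + real (n - i)" using i by (simp add: c_def of_nat_diff)
      then show "(1 - x) powr (c - real i) = (1 - x) powr a * (2 * - w) ^ (n - i)"
        using x unfolding x_w[symmetric] by (simp add: powr_add powr_realpow del: of_nat_diff)
      have "real n - real (n - i) = real i" using i by (simp add: of_nat_diff)
      then show "(1 + x) powr (real n - real (n - i)) = (2 * (1 + w)) ^ i"
        using x unfolding x_w[symmetric] by (simp add: powr_realpow del: of_nat_diff)
    qed
    have sgn: "(- 1) ^ i * (2 * - w) ^ (n - i) * (2 * (1 + w)) ^ i = (- 2) ^ n * w ^ (n - i) * (1 + w) ^ i"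
    proof -
      have "(- 2 :: real) ^ n = (- 2) ^ (n - i) * (- 2) ^ i" using i by (simp flip: power_add)
      also have "(- 2 :: real) ^ i = (- 1) ^ i * 2 ^ i" by (simp flip: power_mult_distrib)
      finally have "(- 2) ^ n * w ^ (n - i) * (1 + w) ^ i =
         (- 1) ^ i * ((- 2) ^ (n - i) * w ^ (n - i)) * (2 ^ i * (1 + w) ^ i)" by (simp only: mult_ac)
      then show ?thesis by (simp only: power_mult_distrib[symmetric]) simp
    qed
    have facts: "pochhammer (c - real i + 1) i = fact i * (c gchoose i)"
      "pochhammer (real n - real (n - i) + 1) (n - i) = fact (n - i) * real (n choose i)"
      using i by (simp_all add: gbinomial_pochhammer' binomial_symmetric[of i n] binomial_gbinomial)
    have fact_n: "real (n choose i) * (fact i * fact (n - i)) = fact n"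
      using i by (simp add: binomial_fact)
    have "real (n choose i) *
       (((- 1) ^ i * pochhammer (c - real i + 1) i * (1 - x) powr (c - real i)) *
        (pochhammer (real n - real (n - i) + 1) (n - i) * (1 + x) powr (real n - real (n - i)))) =
       (1 - x) powr a * ((c gchoose i) * real (n choose i)) *
       (real (n choose i) * (fact i * fact (n - i))) *
       ((- 1) ^ i * (2 * - w) ^ (n - i) * (2 * (1 + w)) ^ i)"
      unfolding pows facts by (simp only: mult_ac)
    then show "real (n choose i) *
       (((- 1) ^ i * pochhammer (c - real i + 1) i * (1 - x) powr (c - real i)) *
        (pochhammer (real n - real (n - i) + 1) (n - i) * (1 + x) powr (real n - real (n - i)))) =
       (1 - x) powr a * (fact n * (- 2) ^ n) *
       ((c gchoose i) * real (n choose i) * w ^ (n - i) * (1 + w) ^ i)"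
      unfolding fact_n sgn by (simp only: mult_ac)
  qed
  also have "\<dots> = (1 - x) powr a * (fact n * (- 2) ^ n) *
      (\<Sum>i\<le>n. (c gchoose i) * real (n choose i) * w ^ (n - i) * (1 + w) ^ i)"
    by (rule sum_distrib_left[symmetric])
  also have "(\<Sum>i\<le>n. (c gchoose i) * real (n choose i) * w ^ (n - i) * (1 + w) ^ i) =
      (\<Sum>i\<le>n. (c gchoose (n - i)) * real (n choose i) * w ^ i * (1 + w) ^ (n - i))"
    by (rule sum.reindex_bij_witness[where i = "\<lambda>i. n - i" and j = "\<lambda>i. n - i"])
       (auto simp: binomial_symmetric[symmetric])
  also have "\<dots> = (\<Sum>j\<le>n. real (n choose j) * ((c + real j) gchoose n) * w ^ j)"
    by (rule sum_gbinomial_shift_powers)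
  also have "\<dots> = poly ?q x"
    unfolding poly_sum
    by (intro sum.cong refl) (simp add: w_def c_def gbinomial_pochhammer' poly_power field_simps)
  finally have D: "(deriv ^^ n) (\<lambda>t. (1 - t) powr c * (1 + t) powr real n) x =
      (1 - x) powr a * (fact n * (- 2) ^ n) * poly ?q x" .
  have "(- 1) ^ n * (- 2 :: real) ^ n = 2 ^ n" by (simp flip: power_mult_distrib)
  then show "poly ?q x = jacobi_rodrigues n a 0 x"
    using x D by (simp add: jacobi_rodrigues_def c_def powr_minus field_simps)
qed

text \<open>
  The summation range may be any \<open>N \<ge> n\<close>, so that Jacobi polynomials of different degrees can be compared
  over a common range.
\<close>

lemma poly_jacobi:
  assumes "n \<le> N"
  shows "poly (jacobi n a 0) z =
     (\<Sum>j\<le>N. real (n choose j) * (pochhammer (a + real j + 1) n / fact n) * ((z - 1) / 2) ^ j)"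
proof -
  have "poly (jacobi n a 0) z =
     (\<Sum>j\<le>n. real (n choose j) * (pochhammer (a + real j + 1) n / fact n) * ((z - 1) / 2) ^ j)"
    by (simp add: jacobi_eq_sum poly_sum poly_power diff_divide_distrib)
  also have "\<dots> =
     (\<Sum>j\<le>N. real (n choose j) * (pochhammer (a + real j + 1) n / fact n) * ((z - 1) / 2) ^ j)"
    using assms by (intro sum.mono_neutral_left) auto
  finally show ?thesis .
qed

section \<open>The Jacobi connection identity\<close>

lemma has_derivative_pochhammer:
  fixes x :: real
  assumes "x > 0"
  shows "((\<lambda>x. pochhammer x n) has_real_derivative pochhammer x n * (\<Sum>i<n. 1 / (x + real i))) (at x)"
proof (induction n)
  case (Suc n)
  have "x + real n > 0" using assms by simp
  then show ?case
    unfolding pochhammer_Suc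
    by (intro DERIV_cong[OF DERIV_mult[OF Suc DERIV_add[OF DERIV_ident DERIV_const[of "real n"]]]])
       (simp add: field_simps)
qed simp

text \<open>
  For \<open>j \<le> m \<le> n\<close> the numerator is \<open>n!/m! (n-j)!/(m-j)!\<close>. Written with rising factorials it vanishes
  by itself for \<open>m < j \<le> n\<close>, so that the range of a sum over \<open>m\<close> need not depend on \<open>j\<close>.
\<close>

definition jacobi_kernel :: "real \<Rightarrow> nat \<Rightarrow> nat \<Rightarrow> nat \<Rightarrow> real" where
  "jacobi_kernel a n j m =
     pochhammer (real m + 1) (n - m) * pochhammer (real m - real j + 1) (n - m) /
     (pochhammer (a + real m + 1) (n - m) * pochhammer (a + real j + real m + 1) (n - m))"

lemma jacobi_kernel_step_degree:
  assumes "a > - 1" "m < n"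
  shows "jacobi_kernel a n j m * ((a + real m + 1) * (a + real j + real m + 1)) =
         jacobi_kernel a n j (Suc m) * ((real m + 1) * (real m - real j + 1))"
proof -
  define r where "r = n - Suc m"
  have r: "n - m = Suc r" "n - Suc m = r" using assms by (auto simp: r_def)
  have pos: "a + real m + 1 > 0" "a + real j + real m + 1 > 0" using assms by auto
  have "pochhammer (a + real m + 2) r > 0" "pochhammer (a + real j + real m + 2) r > 0"
    using assms by (auto intro!: pochhammer_pos)
  moreover have "(x * X) * (y * Y) / ((f * F) * (g * G)) * (f * g) = X * Y / (F * G) * (x * y)"
    if "f > 0" "g > 0" "F > 0" "G > 0" for x X y Y f F g G :: real
    using that by (simp add: field_simps)
  ultimately show ?thesis
    using pos unfolding jacobi_kernel_def r pochhammer_rec by (simp add: add_ac diff_add_eq)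
qed

text \<open>
  Replacing \<open>j\<close> by \<open>j + 1\<close> shifts two of the four rising factorials by one, so the ratio of the two kernels
  is \<open>f m / f n\<close> with \<open>f t = (t - j) (a + j + t + 1)\<close>.
\<close>

lemma jacobi_kernel_step_power:
  assumes "a > - 1" "m < n" "j < n"
  shows "jacobi_kernel a n (Suc j) m * ((real n - real j) * (a + real j + real n + 1)) =
         jacobi_kernel a n j m * ((real m - real j) * (a + real j + real m + 1))"
proof -
  define r where "r = n - Suc m"
  have r: "n - m = Suc r" and n: "real n = real m + real r + 1" using assms by (auto simp: r_def)
  define p q where "p = pochhammer (real m - real j + 1) r"
    and "q = pochhammer (a + real j + real m + 2) r"
  have q: "q > 0" unfolding q_def using assms by (auto intro!: pochhammer_pos)
  have last: "pochhammer (real m - real j + 1) (Suc r) = p * (real n - real j)"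
    "pochhammer (a + real (Suc j) + real m + 1) (Suc r) = q * (a + real j + real n + 1)"
    unfolding p_def q_def by (simp_all add: pochhammer_Suc n algebra_simps)
  have first: "pochhammer (real m - real (Suc j) + 1) (Suc r) = (real m - real j) * p"
    "pochhammer (a + real j + real m + 1) (Suc r) = (a + real j + real m + 1) * q"
    unfolding p_def q_def by (simp_all add: pochhammer_rec algebra_simps)
  have pos: "a + real j + real m + 1 > 0" "a + real j + real n + 1 > 0" using assms by auto
  define t where "t = pochhammer (a + real m + 1) (Suc r)"
  have "t > 0"
    unfolding t_def using assms by (intro pochhammer_pos) auto
  have cancel: "X * (M * p) / (t * (q * e)) * (d * e) = X * (p * d) / (t * (f * q)) * (M * f)"
    if "e > 0" "f > 0" for X M d e f
    using that q \<open>t > 0\<close> by (simp add: field_simps)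
  show ?thesis
    unfolding jacobi_kernel_def r first last t_def[symmetric] by (rule cancel) (use pos in auto)
qed

lemma jacobi_kernel_eq_0:
  assumes "m < j" "j \<le> n"
  shows "jacobi_kernel a n j m = 0"
proof -
  have "pochhammer (real m - real j + 1) (n - m) = 0"
    unfolding pochhammer_eq_0_iff using assms by (intro exI[of _ "j - m - 1"]) (auto simp: of_nat_diff)
  then show ?thesis by (simp add: jacobi_kernel_def)
qed

lemma jacobi_kernel_self: "jacobi_kernel a n j n = 1"
  by (simp add: jacobi_kernel_def)

text \<open>
  Write \<open>F j\<close> for the left-hand side. By \<open>jacobi_kernel_step_power\<close> each summand of \<open>F j - F (j + 1)\<close> contains
  the factor \<open>1 - f m / f n\<close>, and \<open>f n - f m = (n - m) (a + n + m + 1)\<close> is just the denominator of the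
  weight. What remains is \<open>(a + 2 m + 1) / f n\<close> times the kernel, and
  \<open>(a + m + 1) (a + j + m + 1) - m (m - j) = (a + j + 1) (a + 2 m + 1)\<close> shows that it is the difference
  of \<open>V\<close> at \<open>m + 1\<close> and \<open>m\<close>.
\<close>

lemma sum_jacobi_kernel:
  assumes a: "a > - 1" and "j \<le> n"
  shows "(\<Sum>m<n. (a + 2 * real m + 1) / ((real n - real m) * (a + real n + real m + 1)) * jacobi_kernel a n j m) =
         (\<Sum>i<n. 1 / (a + real j + 1 + real i)) - (\<Sum>i<n. 1 / (a + real n + 1 + real i))"
  using \<open>j \<le> n\<close>
proof (induction j rule: inc_induct)
  case base
  show ?case by (simp add: jacobi_kernel_eq_0)
next
  case (step j)
  let ?c = "\<lambda>m. (a + 2 * real m + 1) / ((real n - real m) * (a + real n + real m + 1))"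
  define \<kappa> where "\<kappa> = (a + real j + 1) * ((real n - real j) * (a + real j + real n + 1))"
  define V where "V = (\<lambda>m. jacobi_kernel a n j m * (real m * (real m - real j)) / \<kappa>)"
  have pos: "a + real j + 1 > 0" "real n - real j > 0" "a + real j + real n + 1 > 0"
    using a step.hyps by auto
  have telescope: "?c m * jacobi_kernel a n j m - ?c m * jacobi_kernel a n (Suc j) m = V (Suc m) - V m"
    if m: "m < n" for m
  proof -
    define K where "K = jacobi_kernel a n j m"
    have pos': "real n - real m > 0" "a + real n + real m + 1 > 0" using a m by auto
    have power: "jacobi_kernel a n (Suc j) m =
       K * ((real m - real j) * (a + real j + real m + 1)) / ((real n - real j) * (a + real j + real n + 1))"
      using jacobi_kernel_step_power[OF a m step.hyps(2)] pos by (subst eq_divide_eq) (auto simp: K_def)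
    have V: "V (Suc m) = K * ((a + real m + 1) * (a + real j + real m + 1)) / \<kappa>"
      using jacobi_kernel_step_degree[OF a m, of j] by (simp add: V_def K_def add_ac)
    have "?c m * K - ?c m * jacobi_kernel a n (Suc j) m =
       ?c m * K * ((real n - real m) * (a + real n + real m + 1)) / ((real n - real j) * (a + real j + real n + 1))"
    proof -
      have diff: "(real n - real j) * (a + real j + real n + 1) - (real m - real j) * (a + real j + real m + 1) =
            (real n - real m) * (a + real n + real m + 1)" by (simp add: algebra_simps)
      have gen: "c * K - c * (K * B / A) = c * K * (A - B) / A" if "A \<noteq> 0" for c A B :: real
        using that by (simp add: field_simps)
      show ?thesis
        unfolding power diff[symmetric] by (rule gen) (use pos in simp)
    qed
    also have "\<dots> = K * ((a + 2 * real m + 1) * (a + real j + 1)) / \<kappa>"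
    proof -
      have "X / Y * K * Y / Z = K * (X * e) / (e * Z)" if "Y \<noteq> 0" "e \<noteq> 0" for X Y Z e :: real
        using that by simp
      then show ?thesis unfolding \<kappa>_def by this (use pos pos' in auto)
    qed
    also have "\<dots> = V (Suc m) - V m"
      unfolding V by (simp add: V_def K_def diff_divide_distrib[symmetric]) (simp add: algebra_simps)
    finally show ?thesis by (simp add: K_def)
  qed
  have "(\<Sum>m<n. ?c m * jacobi_kernel a n j m) - (\<Sum>m<n. ?c m * jacobi_kernel a n (Suc j) m) =
        (\<Sum>m<n. V (Suc m) - V m)"
    using telescope by (simp flip: sum_subtractf)
  also have "\<dots> = V n - V 0" by (rule sum_lessThan_telescope)
  also have "\<dots> = 1 / (a + real j + 1) - 1 / (a + real j + real n + 1)"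
  proof -
    have "1 * (N * d) / (e * (d * f)) - 0 = 1 / e - 1 / f" if "d \<noteq> 0" "e \<noteq> 0" "f \<noteq> 0" "f = e + N"
      for N d e f :: real
    proof -
      have "1 / e - 1 / f = N / (e * f)" using that by (simp add: divide_simps)
      then show ?thesis using that(1) by simp
    qed
    then have "1 * (real n * (real n - real j)) /
        ((a + real j + 1) * ((real n - real j) * (a + real j + real n + 1))) - 0 =
        1 / (a + real j + 1) - 1 / (a + real j + real n + 1)"
      by this (use pos in auto)
    then show ?thesis by (simp add: V_def jacobi_kernel_self \<kappa>_def)
  qed
  also have "\<dots> = (\<Sum>i<n. 1 / (a + real j + 1 + real i) - 1 / (a + real j + 1 + real (Suc i)))"
    by (subst sum_lessThan_telescope') (simp add: add_ac)
  finally show ?case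
    using step.IH by (simp add: sum_subtractf add_ac)
qed

text \<open>
  Taking the coefficient of \<open>w\<^sup>j\<close> in \<open>P\<^sub>n\<close> out of those in the lower \<open>P\<^sub>m\<close> leaves the kernel. This is the
  link from \<open>sum_jacobi_kernel\<close> to polynomials.
\<close>

lemma jacobi_connection_coefficient:
  assumes a: "a > - 1" and "j \<le> n" "m < n"
  shows "pochhammer (real m + 1) (n - m) / pochhammer (a + real m + 1) (n - m) *
           (real (m choose j) * (pochhammer (a + real j + 1) m / fact m)) =
         real (n choose j) * (pochhammer (a + real j + 1) n / fact n) * jacobi_kernel a n j m"
proof (cases "j \<le> m")
  case False
  then show ?thesis using assms by (simp add: jacobi_kernel_eq_0 binomial_eq_0)
next
  case True
  have "pochhammer (a + real j + 1) n =
        pochhammer (a + real j + 1) m * pochhammer (a + real j + real m + 1) (n - m)"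
    using pochhammer_product[of m n "a + real j + 1"] assms by (simp add: add_ac)
  moreover have "fact (n - j) = fact (m - j) * pochhammer (real m - real j + 1) (n - m)"
    using pochhammer_product[of "m - j" "n - j" "1::real"] True assms
    by (simp add: of_nat_diff add_ac flip: pochhammer_fact)
  moreover have "pochhammer (a + real j + real m + 1) (n - m) > 0" "pochhammer (a + real m + 1) (n - m) > 0"
    using a by (auto intro!: pochhammer_pos)
  moreover have "pochhammer (real m - real j + 1) (n - m) > 0"
    using True by (intro pochhammer_pos) auto
  ultimately show ?thesis
    using True assms by (simp add: jacobi_kernel_def binomial_fact field_simps)
qed

text \<open>
  The logarithmic derivative of the coefficient of \<open>w\<^sup>j\<close> is split into its value \<open>H\<close> at \<open>j = n\<close>, which is
  the same for all coefficients, and a rest that \<open>sum_jacobi_kernel\<close> distributes over lower degrees.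
\<close>

lemma jacobi_parametric_derivative:
  assumes a: "a > - 1"
  shows "((\<lambda>a. poly (jacobi n a 0) z) has_real_derivative
     (\<Sum>i<n. 1 / (a + real n + 1 + real i)) * poly (jacobi n a 0) z +
     (\<Sum>m<n. (a + 2 * real m + 1) / ((real n - real m) * (a + real n + real m + 1)) *
        (pochhammer (real m + 1) (n - m) / pochhammer (a + real m + 1) (n - m)) * poly (jacobi m a 0) z)) (at a)"
proof -
  let ?c = "\<lambda>m. (a + 2 * real m + 1) / ((real n - real m) * (a + real n + real m + 1))"
  let ?k = "\<lambda>m. pochhammer (real m + 1) (n - m) / pochhammer (a + real m + 1) (n - m)"
  let ?J = "\<lambda>m j. real (m choose j) * (pochhammer (a + real j + 1) m / fact m)"
  let ?w = "(z - 1) / 2"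
  let ?H = "\<Sum>i<n. 1 / (a + real n + 1 + real i)"
  have "((\<lambda>a. real (n choose j) * (pochhammer (a + real j + 1) n / fact n) * ?w ^ j) has_real_derivative
        ?J n j * (\<Sum>i<n. 1 / (a + real j + 1 + real i)) * ?w ^ j) (at a)" for j
  proof -
    have "((\<lambda>a. pochhammer (a + real j + 1) n) has_real_derivative
         pochhammer (a + real j + 1) n * (\<Sum>i<n. 1 / (a + real j + 1 + real i))) (at a)"
      using has_derivative_pochhammer[of "a + (real j + 1)" n] a
        DERIV_shift[of "\<lambda>x. pochhammer x n" _ a "real j + 1"]
      by (simp add: add.assoc)
    then have "((\<lambda>a. real (n choose j) / fact n * ?w ^ j * pochhammer (a + real j + 1) n) has_real_derivative
         real (n choose j) / fact n * ?w ^ j *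
         (pochhammer (a + real j + 1) n * (\<Sum>i<n. 1 / (a + real j + 1 + real i)))) (at a)"
      by (rule DERIV_cmult)
    then show ?thesis by (simp add: mult_ac)
  qed
  then have "((\<lambda>a. poly (jacobi n a 0) z) has_real_derivative
      (\<Sum>j\<le>n. ?J n j * (\<Sum>i<n. 1 / (a + real j + 1 + real i)) * ?w ^ j)) (at a)"
    unfolding poly_jacobi[OF order_refl] by (intro DERIV_sum)
  also have "(\<Sum>j\<le>n. ?J n j * (\<Sum>i<n. 1 / (a + real j + 1 + real i)) * ?w ^ j) =
      (\<Sum>j\<le>n. ?H * (?J n j * ?w ^ j) + (\<Sum>m<n. ?c m * ?k m * (?J m j * ?w ^ j)))"
  proof (rule sum.cong[OF refl])
    fix j assume "j \<in> {..n}"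
    then have j: "j \<le> n" by simp
    have "(\<Sum>i<n. 1 / (a + real j + 1 + real i)) = ?H + (\<Sum>m<n. ?c m * jacobi_kernel a n j m)"
      using sum_jacobi_kernel[OF a j] by simp
    then have "?J n j * (\<Sum>i<n. 1 / (a + real j + 1 + real i)) * ?w ^ j =
       ?H * (?J n j * ?w ^ j) + (\<Sum>m<n. ?c m * (?J n j * jacobi_kernel a n j m) * ?w ^ j)"
      by (simp only: distrib_left distrib_right sum_distrib_left sum_distrib_right mult_ac)
    also have "(\<Sum>m<n. ?c m * (?J n j * jacobi_kernel a n j m) * ?w ^ j) =
        (\<Sum>m<n. ?c m * ?k m * (?J m j * ?w ^ j))"
      by (rule sum.cong[OF refl], subst jacobi_connection_coefficient[OF a j, symmetric])
         (auto simp: mult_ac)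
    finally show "?J n j * (\<Sum>i<n. 1 / (a + real j + 1 + real i)) * ?w ^ j =
       ?H * (?J n j * ?w ^ j) + (\<Sum>m<n. ?c m * ?k m * (?J m j * ?w ^ j))" .
  qed
  also have "\<dots> = ?H * (\<Sum>j\<le>n. ?J n j * ?w ^ j) + (\<Sum>m<n. ?c m * ?k m * (\<Sum>j\<le>n. ?J m j * ?w ^ j))"
    unfolding sum.distrib sum_distrib_left by (subst (2) sum.swap) simp
  also have "\<dots> = ?H * poly (jacobi n a 0) z + (\<Sum>m<n. ?c m * ?k m * poly (jacobi m a 0) z)"
    by (intro arg_cong2[where f = "(+)"] arg_cong2[where f = "(*)"] sum.cong refl)
       (simp_all add: poly_jacobi[where N = n])
  finally show ?thesis .
qed

section \<open>Parametric derivatives of Koornwinder polynomials\<close>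

lemma koornwinder_derivative_alpha:
  "((\<lambda>a. koornwinder a \<beta> n k x y) has_real_derivative
     (\<Sum>s<n - k. 1 / real (n - k - s) * koornwinder \<alpha> \<beta> (k + s) k x y)) (at \<alpha>)"
proof -
  have "((\<lambda>a. poly (laguerre (n - k) (a + (2 * real k + 1))) x) has_real_derivative
      (\<Sum>s<n - k. 1 / real (n - k - s) * poly (laguerre s (\<alpha> + (2 * real k + 1))) x)) (at \<alpha>)"
    using laguerre_parametric_derivative[of "n - k" x "\<alpha> + (2 * real k + 1)"]
      DERIV_shift[of "\<lambda>a. poly (laguerre (n - k) a) x" _ \<alpha> "2 * real k + 1"] by blast
  from DERIV_cmult_right[OF this, of "x ^ k * poly (jacobi k \<beta> 0) (y / x)"] show ?thesis
    by (simp add: koornwinder_def sum_distrib_right add.assoc mult.assoc)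
qed

text \<open>
  Lowering \<open>n\<close> and \<open>k\<close> by \<open>s + 1\<close> keeps \<open>n - k\<close>, and the shift of \<open>\<alpha>\<close> by \<open>2 s + 2\<close> makes up for the
  smaller \<open>k\<close> in the Laguerre parameter. So the Laguerre factor is unchanged, the power \<open>x\<^sup>s\<^sup>+\<^sup>1\<close> in
  \<open>beta_coeff\<close> restores \<open>x\<^sup>k\<close>, and only the Jacobi factor moves, to degree \<open>k - s - 1\<close>.
\<close>

lemma beta_coeff_times_koornwinder:
  assumes "s < k" "k \<le> n"
  shows "beta_coeff \<beta> k s x * koornwinder (\<alpha> + 2 * real s + 2) \<beta> (n - s - 1) (k - s - 1) x y =
     poly (laguerre (n - k) (\<alpha> + 2 * real k + 1)) x * x ^ k *
     ((\<beta> + 2 * real (k - Suc s) + 1) / ((real k - real (k - Suc s)) * (\<beta> + real k + real (k - Suc s) + 1)) *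
      (pochhammer (real (k - Suc s) + 1) (k - (k - Suc s)) /
       pochhammer (\<beta> + real (k - Suc s) + 1) (k - (k - Suc s))) *
      poly (jacobi (k - Suc s) \<beta> 0) (y / x))"
proof -
  have r: "real (k - Suc s) = real k - real s - 1" using assms by (simp add: of_nat_diff)
  have d: "k - (k - Suc s) = s + 1" "n - s - 1 - (k - Suc s) = n - k" "k - s - 1 = k - Suc s"
    using assms by auto
  have args: "\<beta> + 2 * (real k - real s - 1) + 1 = \<beta> + 2 * real k - 2 * real s - 1"
    "real k - (real k - real s - 1) = real s + 1"
    "\<beta> + real k + (real k - real s - 1) + 1 = \<beta> + 2 * real k - real s"
    "real k - real s - 1 + 1 = real k - real s"
    "\<beta> + (real k - real s - 1) + 1 = \<beta> + real k - real s"
    "\<alpha> + 2 * real s + 2 + 2 * (real k - real s - 1) + 1 = \<alpha> + 2 * real k + 1"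
    by simp_all
  have "x ^ k = x ^ (s + 1) * x ^ (k - Suc s)"
    using assms by (simp flip: power_add power_Suc)
  then show ?thesis
    unfolding beta_coeff_def koornwinder_def d r args by simp
qed

lemma koornwinder_derivative_beta:
  assumes "\<beta> > - 1" "k \<le> n"
  shows "((\<lambda>b. koornwinder \<alpha> b n k x y) has_real_derivative
     (\<Sum>s<k. 1 / (\<beta> + real k + real s + 1) * koornwinder \<alpha> \<beta> n k x y)
     + (\<Sum>s<k. beta_coeff \<beta> k s x *
          koornwinder (\<alpha> + 2 * real s + 2) \<beta> (n - s - 1) (k - s - 1) x y)) (at \<beta>)"
proof -
  let ?L = "poly (laguerre (n - k) (\<alpha> + 2 * real k + 1)) x * x ^ k"
  let ?t = "\<lambda>m. (\<beta> + 2 * real m + 1) / ((real k - real m) * (\<beta> + real k + real m + 1)) *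
        (pochhammer (real m + 1) (k - m) / pochhammer (\<beta> + real m + 1) (k - m)) *
        poly (jacobi m \<beta> 0) (y / x)"
  have "(\<Sum>s<k. beta_coeff \<beta> k s x *
          koornwinder (\<alpha> + 2 * real s + 2) \<beta> (n - s - 1) (k - s - 1) x y) =
        (\<Sum>s<k. ?L * ?t (k - Suc s))"
    using assms(2) by (intro sum.cong refl beta_coeff_times_koornwinder) auto
  also have "\<dots> = ?L * (\<Sum>m<k. ?t m)"
    unfolding sum_distrib_left[symmetric] by (simp only: sum.nat_diff_reindex[where g = ?t and n = k])
  finally have t: "(\<Sum>s<k. beta_coeff \<beta> k s x *
          koornwinder (\<alpha> + 2 * real s + 2) \<beta> (n - s - 1) (k - s - 1) x y) = ?L * (\<Sum>m<k. ?t m)" .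
  have h: "(\<Sum>s<k. 1 / (\<beta> + real k + real s + 1) * koornwinder \<alpha> \<beta> n k x y) =
      ?L * ((\<Sum>i<k. 1 / (\<beta> + real k + 1 + real i)) * poly (jacobi k \<beta> 0) (y / x))"
    unfolding koornwinder_def by (simp add: sum_distrib_left sum_distrib_right add_ac mult_ac)
  show ?thesis
    unfolding t h distrib_left[symmetric]
    using DERIV_cmult[OF jacobi_parametric_derivative[OF assms(1), of k "y / x"], of ?L]
    by (simp only: koornwinder_def)
qed

section \<open>No expansion with coefficients independent of x\<close>

text \<open>
  For \<open>n > 1\<close> the coefficients of \<open>x\<^sup>n\<close>, \<open>x\<^sup>n\<^sup>-\<^sup>1\<close> and \<open>x\<^sup>0\<close> give three linear equations for
  \<open>A\<close>, \<open>B\<close>, \<open>C\<close>, whose determinant is \<open>(a + 1) (n - 1)\<close> up to a nonzero factor. For \<open>n = 1\<close>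
  the smaller Laguerre polynomial is \<open>1\<close>, and nontrivial solutions exist.
\<close>

lemma linear_times_laguerre_eq_laguerre:
  fixes a A B C :: real
  assumes "a > - 1" and "n \<ge> 1"
    and eq: "[:B, A:] * laguerre (n - 1) (a + 2) = smult C (laguerre n a)"
  shows "n = 1 \<and> A = - C \<and> B = C * (a + 1) \<or> A = 0 \<and> B = 0"
proof (cases "n = 1")
  case True
  have "coeff ([:B, A:] * laguerre (n - 1) (a + 2)) i = coeff (smult C (laguerre n a)) i" for i
    by (simp only: eq)
  from this[of 0] this[of 1] True show ?thesis
    by (simp add: coeff_laguerre)
next
  case False
  define r where "r = n - 2"
  have n: "n = Suc (Suc r)" using assms(2) False by (simp add: r_def)
  have coeff: "coeff ([:B, A:] * laguerre (Suc r) (a + 2)) i = coeff (smult C (laguerre (Suc (Suc r)) a)) i" for i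
    using eq by (simp add: n)
  have top: "A * (real r + 2) = - C"
  proof -
    define F :: real where "F = fact (Suc r)"
    have "A * ((- 1) ^ Suc r / F) = C * ((- 1) ^ Suc (Suc r) / fact (Suc (Suc r)))"
      using coeff[of "Suc (Suc r)"] by (simp add: coeff_laguerre F_def del: fact_Suc)
    also have "fact (Suc (Suc r)) = (real r + 2) * F"
      unfolding F_def by (subst fact_Suc) simp
    finally have "(- 1) ^ Suc r * (A / F) = (- 1) ^ Suc r * - (C / ((real r + 2) * F))"
      by (simp add: mult.commute)
    then have "A / F = - (C / ((real r + 2) * F))"
      by (subst (asm) mult_left_cancel) auto
    moreover have "F > 0" by (simp add: F_def)
    moreover have "A * R = - C" if "A / F = - (C / (R * F))" "F > 0" "R > 0" for F R :: real
    proof -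
      have "A * R = A / F * (R * F)" using that(2) by simp
      also have "\<dots> = - C" unfolding that(1) using that(2,3) by simp
      finally show ?thesis .
    qed
    ultimately show ?thesis by simp
  qed
  have next_top: "B - A * (real r + 1) * (a + real r + 3) = C * (a + real r + 2)"
  proof -
    define G :: real where "G = fact r"
    define u :: real where "u = (- 1) ^ r"
    have G: "G > 0" "fact (Suc r) = (real r + 1) * G" by (simp_all add: G_def)
    have u: "u \<noteq> 0" by (simp add: u_def)
    have "B * (- u / ((real r + 1) * G)) + A * (u * (a + real r + 3) / G) =
          C * (- u * (a + real r + 2) / ((real r + 1) * G))"
      using coeff[of "Suc r"] G_def
      by (simp add: coeff_laguerre G(2) u_def add_ac del: fact_Suc)
    moreover have "B - A * R * M = C * N"
      if "B * (- u / (R * G)) + A * (u * M / G) = C * (- u * N / (R * G))" "R > 0" for R M N :: real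
    proof -
      have "- u * (B - A * R * M) = (B * (- u / (R * G)) + A * (u * M / G)) * (R * G)"
        using that(2) G(1) by (simp add: field_simps)
      also have "\<dots> = - u * (C * N)" unfolding that(1) using that(2) G(1) by simp
      finally show ?thesis using u by simp
    qed
    ultimately show ?thesis by simp
  qed
  define p where "p = pochhammer (a + 3) (Suc r)"
  have p: "p > 0" unfolding p_def using assms(1) by (intro pochhammer_pos) auto
  have "pochhammer (a + 1) (Suc (Suc r)) * (a + real r + 3) = pochhammer (a + 1) (Suc (Suc (Suc r)))"
    by (simp add: pochhammer_Suc[of _ "Suc (Suc r)"] add_ac)
  also have "\<dots> = (a + 1) * (a + 2) * p"
    unfolding p_def by (simp add: pochhammer_rec[of _ "Suc (Suc r)"] pochhammer_rec[of "a + 2"] add_ac)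
  finally have q: "pochhammer (a + 1) (Suc (Suc r)) * (a + real r + 3) = (a + 1) * (a + 2) * p" .
  have "B * (real r + 2) * p = C * pochhammer (a + 1) (Suc (Suc r))"
  proof -
    define F :: real where "F = fact (Suc r)"
    have "fact (Suc (Suc r)) = (real r + 2) * F"
      unfolding F_def by (subst fact_Suc) simp
    then have "B * (p / F) = C * (pochhammer (a + 1) (Suc (Suc r)) / ((real r + 2) * F))"
      using coeff[of 0] by (simp add: coeff_laguerre p_def F_def add_ac del: fact_Suc)
    moreover have "B * R * p = C * q" if "B * (p / F) = C * (q / (R * F))" "R > 0" for R q :: real
    proof -
      have F: "F > 0" by (simp add: F_def)
      then have "B * R * p = B * (p / F) * (R * F)" by simp
      also have "\<dots> = C * q" unfolding that(1) using F that(2) by simp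
      finally show ?thesis .
    qed
    ultimately show ?thesis by simp
  qed
  then have "(B * (real r + 2) * p) * (a + real r + 3) =
      C * (pochhammer (a + 1) (Suc (Suc r)) * (a + real r + 3))"
    by simp
  then have "(B * (real r + 2) * (a + real r + 3)) * p = (C * (a + 1) * (a + 2)) * p"
    unfolding q by (simp only: mult_ac)
  then have bottom: "B * (real r + 2) * (a + real r + 3) = C * (a + 1) * (a + 2)"
    using p by simp
  have "C * ((a + 1) * (real r + 1)) = 0"
  proof -
    have "C * (a + real r + 2) * ((real r + 2) * (a + real r + 3)) =
        (B - A * (real r + 1) * (a + real r + 3)) * ((real r + 2) * (a + real r + 3))"
      by (simp only: next_top)
    also have "\<dots> = B * (real r + 2) * (a + real r + 3)
        - A * (real r + 2) * ((real r + 1) * (a + real r + 3) * (a + real r + 3))"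
      by (simp only: algebra_simps)
    also have "\<dots> = C * (a + 1) * (a + 2) + C * ((real r + 1) * (a + real r + 3) * (a + real r + 3))"
      by (simp only: bottom top)
    finally show ?thesis by (simp add: algebra_simps)
  qed
  then have "C = 0" using assms(1) by auto
  with top next_top show ?thesis by simp
qed

lemma koornwinder_0: "koornwinder \<alpha> \<beta> n 0 x y = poly (laguerre n (\<alpha> + 1)) x"
  by (simp add: koornwinder_def poly_jacobi[where N = 0])

lemma koornwinder_1:
  assumes "x \<noteq> 0"
  shows "koornwinder \<alpha> \<beta> n 1 x y =
         poly (laguerre (n - 1) (\<alpha> + 3)) x * (((\<beta> + 2) * y + \<beta> * x) / 2)"
  using assms by (simp add: koornwinder_def poly_jacobi[where N = 1] field_simps)

text \<open>
  The contribution of lower total degree is the same for \<open>k = 0\<close> and \<open>k = 1\<close>, so eliminating it between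
  these two levels leaves an equation between \<open>P\<^sub>n\<^sub>,\<^sub>0\<close>, \<open>P\<^sub>n\<^sub>,\<^sub>1\<close> and the derivative of \<open>P\<^sub>n\<^sub>,\<^sub>1\<close>.
\<close>

lemma not_has_expansion_form_koornwinder:
  assumes "\<alpha> > - 1" "\<beta> > - 1" "n \<ge> 1"
  shows "\<not> has_expansion_form (koornwinder \<alpha>) \<beta> n"
proof
  assume "has_expansion_form (koornwinder \<alpha>) \<beta> n"
  then obtain d e :: "nat \<Rightarrow> nat \<Rightarrow> nat \<Rightarrow> real \<Rightarrow> real" where
    expansion: "\<And>k x y. k \<le> n \<Longrightarrow> x \<noteq> 0 \<Longrightarrow>
        ((\<lambda>b. koornwinder \<alpha> b n k x y) has_real_derivative
          (\<Sum>m<n. \<Sum>j\<le>m. d n j m y * koornwinder \<alpha> \<beta> m j x y)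
          + (\<Sum>j\<le>k. e n j k y * koornwinder \<alpha> \<beta> n j x y)) (at \<beta>)"
    unfolding has_expansion_form_def by blast
  \<comment> \<open>For \<open>n = 1\<close> this value makes \<open>P\<^sub>1\<^sub>,\<^sub>1\<close> proportional to the Laguerre polynomial \<open>\<alpha> + 2 - x\<close>,
      while the derivative of \<open>P\<^sub>1\<^sub>,\<^sub>1\<close> is not. For \<open>n > 1\<close> any nonzero value would do.\<close>
  define y where "y = (if n = 1 then - \<beta> * (\<alpha> + 2) / (\<beta> + 2) else 1)"
  define A where "A = 1 - e n 1 1 y * \<beta>"
  define B where "B = (1 - e n 1 1 y * (\<beta> + 2)) * y"
  define C where "C = 2 * (e n 0 1 y - e n 0 0 y)"
  have "[:B, A:] * laguerre (n - 1) (\<alpha> + 1 + 2) = smult C (laguerre n (\<alpha> + 1))"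
  proof (rule poly_eq_if_agree_on_infinite[of "{0<..}"])
    fix x :: real assume "x \<in> {0<..}"
    then have x: "x \<noteq> 0" by simp
    let ?D = "\<Sum>m<n. \<Sum>j\<le>m. d n j m y * koornwinder \<alpha> \<beta> m j x y"
    let ?L = "poly (laguerre n (\<alpha> + 1)) x" and ?L' = "poly (laguerre (n - 1) (\<alpha> + 3)) x"
    have "((\<lambda>b. koornwinder \<alpha> b n 0 x y) has_real_derivative 0) (at \<beta>)"
      by (simp add: koornwinder_0)
    from DERIV_unique[OF this expansion[of 0 x y]] x
    have level0: "?D + e n 0 0 y * ?L = 0"
      by (simp add: koornwinder_0)
    have "((\<lambda>b. koornwinder \<alpha> b n 1 x y) has_real_derivative ?L' * ((y + x) / 2)) (at \<beta>)"
      unfolding koornwinder_1[OF x] by (auto intro!: derivative_eq_intros)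
    from DERIV_unique[OF this expansion[of 1 x y]] x assms(3)
    have "?L' * ((y + x) / 2) =
        ?D + (e n 0 1 y * ?L + e n 1 1 y * (?L' * (((\<beta> + 2) * y + \<beta> * x) / 2)))"
      using koornwinder_1[OF x, of \<alpha> \<beta> n y] by (simp add: koornwinder_0)
    with level0 have "?L' * (A * x + B) = C * ?L"
      unfolding A_def B_def C_def by (simp add: field_simps)
    then show "poly ([:B, A:] * laguerre (n - 1) (\<alpha> + 1 + 2)) x = poly (smult C (laguerre n (\<alpha> + 1))) x"
      by (simp add: algebra_simps)
  qed (rule infinite_Ioi)
  from linear_times_laguerre_eq_laguerre[OF _ assms(3) this] assms(1)
  consider "n = 1" "A = - C" "B = C * (\<alpha> + 2)" | "A = 0" "B = 0" by force
  then show False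
  proof cases
    case 1
    have y: "(\<beta> + 2) * y = - \<beta> * (\<alpha> + 2)" using 1 assms(2) by (simp add: y_def)
    have "\<beta> + 2 \<noteq> 0" "\<alpha> + 2 \<noteq> 0" using assms by auto
    moreover have "(\<alpha> + 2) * 2 = 0"
    proof -
      have "(1 - e n 1 1 y * (\<beta> + 2)) * ((\<beta> + 2) * y) = (\<beta> + 2) * (C * (\<alpha> + 2))"
        using 1(3) by (simp add: B_def mult_ac)
      moreover have "C = e n 1 1 y * \<beta> - 1" using 1(2) by (simp add: A_def)
      ultimately show ?thesis
        unfolding y by (simp only: algebra_simps)
    qed
    ultimately show False by simp
  next
    case 2
    have "y \<noteq> 0 \<or> n = 1 \<and> \<beta> = 0" using assms by (auto simp: y_def)
    with 2 show False unfolding A_def B_def by (auto simp: algebra_simps)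
  qed
qed

text \<open>
  The coefficient is a positive constant times \<open>x\<^sup>s\<^sup>+\<^sup>1\<close>, so its values at \<open>1\<close> and \<open>2\<close> differ.
\<close>

lemma beta_coeff_depends_on_x:
  assumes "\<beta> > - 1" "s < k"
  shows "\<not> (\<exists>c. \<forall>x. x \<noteq> 0 \<longrightarrow> beta_coeff \<beta> k s x = c)"
proof
  assume "\<exists>c. \<forall>x. x \<noteq> 0 \<longrightarrow> beta_coeff \<beta> k s x = c"
  then have eq: "beta_coeff \<beta> k s 2 = beta_coeff \<beta> k s 1"
    by auto
  have ks: "real k \<ge> real s + 1" using assms(2) by simp
  have "\<beta> + 2 * real k - 2 * real s - 1 > 0" "\<beta> + 2 * real k - real s > 0" "real s + 1 > 0"
    using assms(1) ks by linarith+
  moreover have "pochhammer (real k - real s) (s + 1) > 0" "pochhammer (\<beta> + real k - real s) (s + 1) > 0"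
    using assms(1) ks by (auto intro!: pochhammer_pos)
  ultimately have "beta_coeff \<beta> k s 1 > 0"
    unfolding beta_coeff_def by simp
  moreover have "beta_coeff \<beta> k s 2 = beta_coeff \<beta> k s 1 * 2 ^ (s + 1)"
    by (simp add: beta_coeff_def)
  ultimately have "(2::real) ^ (s + 1) = 1" using eq by simp
  moreover have "(2::real) ^ (s + 1) > 1" by (intro one_less_power) auto
  ultimately show False by simp
qed

theorem theorem3:
  fixes \<alpha> \<beta> :: real
  assumes "\<alpha> > - 1" and "\<beta> > - 1"
  shows
    "(\<forall>n k x y. n \<ge> k + 1 \<and> x \<noteq> 0 \<longrightarrow>
        ((\<lambda>a. koornwinder a \<beta> n k x y) has_real_derivative
          (\<Sum>s=0..n - k - 1. 1 / (real n - real k - real s) * koornwinder \<alpha> \<beta> (k + s) k x y)) (at \<alpha>))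
     \<and> (\<forall>n x y. x \<noteq> 0 \<longrightarrow>
        ((\<lambda>a. koornwinder a \<beta> n n x y) has_real_derivative 0) (at \<alpha>))
     \<and> (\<forall>n k x y. n \<ge> k \<and> k \<ge> 1 \<and> x \<noteq> 0 \<longrightarrow>
        ((\<lambda>b. koornwinder \<alpha> b n k x y) has_real_derivative
          (\<Sum>s=0..k - 1. 1 / (\<beta> + real k + real s + 1) * koornwinder \<alpha> \<beta> n k x y)
          + (\<Sum>s=0..k - 1. beta_coeff \<beta> k s x *
               koornwinder (\<alpha> + 2 * real s + 2) \<beta> (n - s - 1) (k - s - 1) x y)) (at \<beta>))
     \<and> (\<forall>n x y. x \<noteq> 0 \<longrightarrow>
        ((\<lambda>b. koornwinder \<alpha> b n 0 x y) has_real_derivative 0) (at \<beta>))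
     \<and> (\<forall>n\<ge>1. \<not> has_expansion_form (koornwinder \<alpha>) \<beta> n)
     \<and> (\<forall>k s. s < k \<longrightarrow> \<not> (\<exists>c. \<forall>x. x \<noteq> 0 \<longrightarrow> beta_coeff \<beta> k s x = c))"
proof (intro conjI allI impI)
  fix n k :: nat and x y :: real
  assume *: "n \<ge> k + 1 \<and> x \<noteq> 0"
  then have range: "{0..n - k - 1} = {..<n - k}" by auto
  have "(\<Sum>s=0..n - k - 1. 1 / (real n - real k - real s) * koornwinder \<alpha> \<beta> (k + s) k x y) =
     (\<Sum>s<n - k. 1 / real (n - k - s) * koornwinder \<alpha> \<beta> (k + s) k x y)"
    unfolding range by (rule sum.cong[OF refl]) auto
  then show "((\<lambda>a. koornwinder a \<beta> n k x y) has_real_derivative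
      (\<Sum>s=0..n - k - 1. 1 / (real n - real k - real s) * koornwinder \<alpha> \<beta> (k + s) k x y)) (at \<alpha>)"
    by (simp only: koornwinder_derivative_alpha)
next
  fix n :: nat and x y :: real
  show "((\<lambda>a. koornwinder a \<beta> n n x y) has_real_derivative 0) (at \<alpha>)"
    using koornwinder_derivative_alpha[of \<beta> n n x y \<alpha>] by simp
next
  fix n k :: nat and x y :: real
  assume *: "n \<ge> k \<and> k \<ge> 1 \<and> x \<noteq> 0"
  then have range: "{0..k - 1} = {..<k}" by auto
  show "((\<lambda>b. koornwinder \<alpha> b n k x y) has_real_derivative
      (\<Sum>s=0..k - 1. 1 / (\<beta> + real k + real s + 1) * koornwinder \<alpha> \<beta> n k x y)
      + (\<Sum>s=0..k - 1. beta_coeff \<beta> k s x *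
           koornwinder (\<alpha> + 2 * real s + 2) \<beta> (n - s - 1) (k - s - 1) x y)) (at \<beta>)"
    unfolding range by (rule koornwinder_derivative_beta) (use * assms(2) in auto)
next
  fix n :: nat and x y :: real
  show "((\<lambda>b. koornwinder \<alpha> b n 0 x y) has_real_derivative 0) (at \<beta>)"
    using koornwinder_derivative_beta[OF assms(2), of 0 n \<alpha> x y] by simp
next
  fix n :: nat
  assume "n \<ge> 1"
  then show "\<not> has_expansion_form (koornwinder \<alpha>) \<beta> n"
    by (rule not_has_expansion_form_koornwinder[OF assms])
next
  fix k s :: nat
  assume "s < k"
  then show "\<not> (\<exists>c. \<forall>x. x \<noteq> 0 \<longrightarrow> beta_coeff \<beta> k s x = c)"
    by (rule beta_coeff_depends_on_x[OF assms(2)])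
qed

end
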